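(* There is a function $f:\mathbb{N}\to\mathbb{R}$ with $f(w)\to 0$ as $w\to\infty$ such that for every positive integer $w$ and every integer $d\ge 2$, \[ \mathrm{olw}(w,d)\;\ge\;(2-f(w))\binom{w+1}{2}. \] In words: no on-line chain partitioning algorithm partitions every $2$-dimensional poset of width at most $w$ into fewer than $(2-o(1))\binom{w+1}{2}$ chains.
   Context: On-line chain partitioning is a game between two players, Anna and Bertha. In each round Anna introduces a new point and describes the poset induced on all points introduced so far (this poset extends the previously described one). Bertha then irrevocably assigns the new point to a chain, equivalently gives it a color, so that each color class is a chain of the final poset. An on-line chain partitioning algorithm is a strategy for Bertha. For positive integers $w,d$, $\mathrm{olw}(w,d)$ is the largest integer $k$ such that Anna has a strategy forcing every on-line chain partitioning algorithm to use at least $k$ chains, while the poset Anna constructs has width at most $w$ and dimension at most $d$. The dimension of a poset is the least size of a realizer, i.e. of a family of linear extensions whose intersection is the poset. *)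

theory Defs
  imports Complex_Main "HOL-Library.Extended_Real"
begin

definition antichain :: "'a rel \<Rightarrow> 'a set \<Rightarrow> bool" where
  "antichain r S \<longleftrightarrow> (\<forall>x\<in>S. \<forall>y\<in>S. (x, y) \<in> r \<longrightarrow> x = y)"

text \<open>Width and dimension are meant for finite posets only: \<^const>\<open>Max\<close> is then taken over a
  finite nonempty set, and a realizer exists.\<close>

definition width :: "'a set \<Rightarrow> 'a rel \<Rightarrow> nat" where
  "width P r = Max (card ` {S. S \<subseteq> P \<and> antichain r S})"

definition realizer :: "'a set \<Rightarrow> 'a rel \<Rightarrow> 'a rel set \<Rightarrow> bool" where
  "realizer P r L \<longleftrightarrow>
     finite L \<and> L \<noteq> {} \<and> (\<forall>l\<in>L. linear_order_on P l \<and> r \<subseteq> l) \<and> \<Inter>L = r"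

definition dimension :: "'a set \<Rightarrow> 'a rel \<Rightarrow> nat" where
  "dimension P r = (LEAST m. \<exists>L. realizer P r L \<and> card L = m)"

text \<open>Points are named by their order of introduction, so after \<open>n\<close> rounds the point set is
  \<open>{..<n}\<close>. An on-line algorithm for Bertha is a function \<open>B\<close> giving the colour of the newest
  point from the poset presented so far. That poset contains all earlier ones as restrictions, so it
  determines everything that happened before, including Bertha's own earlier choices. In
  a poset \<open>r\<close> on \<open>{..<n}\<close>, point \<open>i\<close> thus gets the colour \<open>B (Restr r {..i})\<close>.\<close>

definition online_algorithm :: "(nat rel \<Rightarrow> nat) \<Rightarrow> bool" where
  "online_algorithm B \<longleftrightarrow>
     (\<forall>n r. partial_order_on {..<n} r \<longrightarrow>
        (\<forall>c. {i. i < n \<and> B (Restr r {..i}) = c} \<in> Chains r))"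

text \<open>A strategy \<open>A\<close> for Anna maps the list of colours that Bertha has used so far (oldest first) to
  the next poset; Anna's own earlier moves are determined by this list.\<close>

primrec colours_after :: "(nat list \<Rightarrow> nat rel) \<Rightarrow> (nat rel \<Rightarrow> nat) \<Rightarrow> nat \<Rightarrow> nat list" where
  "colours_after A B 0 = []"
| "colours_after A B (Suc n) = colours_after A B n @ [B (A (colours_after A B n))]"

primrec poset_after :: "(nat list \<Rightarrow> nat rel) \<Rightarrow> (nat rel \<Rightarrow> nat) \<Rightarrow> nat \<Rightarrow> nat rel" where
  "poset_after A B 0 = {}"
| "poset_after A B (Suc n) = A (colours_after A B n)"

definition legal_play :: "(nat list \<Rightarrow> nat rel) \<Rightarrow> (nat rel \<Rightarrow> nat) \<Rightarrow> nat \<Rightarrow> bool" where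
  "legal_play A B n \<longleftrightarrow>
     (\<forall>m<n. partial_order_on {..<Suc m} (poset_after A B (Suc m)) \<and>
            Restr (poset_after A B (Suc m)) {..<m} = poset_after A B m)"

text \<open>Anna may end the game after any round \<open>n\<close>, in particular as soon as she sees \<open>k\<close> colours.
  Her moves need to be legal only up to then. Bounding the width and dimension of the final
  poset bounds those of all earlier ones, which are induced subposets of it.\<close>

definition anna_forces :: "nat \<Rightarrow> nat \<Rightarrow> nat \<Rightarrow> bool" where
  "anna_forces w d k \<longleftrightarrow>
     (\<exists>A. \<forall>B. online_algorithm B \<longrightarrow>
        (\<exists>n. legal_play A B n \<and>
             width {..<n} (poset_after A B n) \<le> w \<and>
             dimension {..<n} (poset_after A B n) \<le> d \<and>
             k \<le> card (set (colours_after A B n))))"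

text \<open>The supremum is taken in \<^typ>\<open>enat\<close>: it is the largest forcible \<open>k\<close> whenever there is
  one, and the definition does not presuppose a bound on the forcible values.\<close>

definition olw :: "nat \<Rightarrow> nat \<Rightarrow> enat" where
  "olw w d = (SUP k \<in> {k. anna_forces w d k}. enat k)"

end

theory Submission
  imports Defs "HOL-Library.Disjoint_Sets"
begin

text \<open>Szemeredi's argument lets Anna build, with width \<open>k\<close>, a chain with \<open>k\<close> colours which can be made
  incomparable to all later points while everything else is below them. Repeating this next to
  the earlier chains gives \<open>m + 1\<close> pairwise incomparable chains with at least \<open>w - m\<close> colours each,
  disjoint from each other. Above all of them Anna plays the order dual, obtaining a chain with \<open>w\<close>
  colours. These recur with a share of at most \<open>1 / (m + 1)\<close> in one of the lower chains; joined to
  it, they make a chain with about \<open>2 w - m - w / (m + 1)\<close> colours. The game is continued with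
  width \<open>w - 1\<close> on points incomparable to this chain, where none of its colours can be used. With
  \<open>m \<approx> sqrt w\<close>, the sum over all widths is \<open>w\<^sup>2 - O(w powr (3 / 2))\<close>.

  All posets are intersections of two linear orders. Which lower chain is kept is decided late,
  but the part of the poset inside a slot may be re-embedded, in particular with its two linear
  orders exchanged, without changing the poset; so any of the lower chains can be moved to the
  outside.\<close>

section \<open>Forcing\<close>

definition proper :: "nat rel \<Rightarrow> nat list \<Rightarrow> bool" where
  "proper r cols \<longleftrightarrow>
     (\<forall>i<length cols. \<forall>j<length cols. cols ! i = cols ! j \<longrightarrow> (i, j) \<in> r \<or> (j, i) \<in> r)"

text \<open>Winning positions as a game tree: Bertha is present only through the quantifier over
  \<open>c\<close>, restricted by \<open>proper\<close>, so no algorithm has to be carried along.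
  Being inductive, it makes every play end, after a number of rounds that may depend on her
  answers.\<close>

inductive force :: "(nat rel \<Rightarrow> nat list \<Rightarrow> bool) \<Rightarrow> nat rel \<Rightarrow> nat list \<Rightarrow> bool"
  for \<Phi> where
  stop: "\<Phi> r cols \<Longrightarrow> force \<Phi> r cols"
| move: "partial_order_on {..<Suc (length cols)} r' \<Longrightarrow> Restr r' {..<length cols} = r \<Longrightarrow>
    (\<And>c. proper r' (cols @ [c]) \<Longrightarrow> force \<Phi> r' (cols @ [c])) \<Longrightarrow> force \<Phi> r cols"

text \<open>Sequential composition: wherever the first goal is met, Anna plays on for the second.
  The stages of her strategy are joined in this way.\<close>

lemma force_trans:
  assumes "force \<Psi> r cols" and "\<And>r' cols'. \<Psi> r' cols' \<Longrightarrow> force \<Phi> r' cols'"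
  shows "force \<Phi> r cols"
  using assms by (induction rule: force.induct) (auto intro: force.move)

lemma force_mono:
  assumes "force \<Psi> r cols" and "\<And>r' cols'. \<Psi> r' cols' \<Longrightarrow> \<Phi> r' cols'"
  shows "force \<Phi> r cols"
  using assms by (blast intro: force_trans force.stop)

lemma proper_converse [simp]: "proper (r\<inverse>) cols \<longleftrightarrow> proper r cols"
  by (auto simp: proper_def)

text \<open>The game is self-dual: \<open>proper\<close> does not see the direction of the order, so
  Anna can present the converse poset in each round.\<close>

lemma force_converse:
  assumes "force \<Phi> r cols"
  shows "force (\<lambda>r cols. \<Phi> (r\<inverse>) cols) (r\<inverse>) cols"
  using assms
proof (induction rule: force.induct)
  case (stop r cols)
  then show ?case by (simp add: force.stop)
next
  case (move cols r' r)
  show ?case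
  proof (rule force.move)
    show "partial_order_on {..<Suc (length cols)} (r'\<inverse>)"
      using move(1) by simp
    show "Restr (r'\<inverse>) {..<length cols} = r\<inverse>"
      using move(2) by auto
  qed (use move in auto)
qed

section \<open>From winning positions to strategies against algorithms\<close>

definition step :: "(nat list \<Rightarrow> nat rel) \<Rightarrow> (nat rel \<Rightarrow> nat) \<Rightarrow> nat rel \<times> nat list \<Rightarrow> nat rel \<times> nat list"
  where "step A B p = (A (snd p), snd p @ [B (A (snd p))])"

text \<open>Legality of a play resumed at \<open>p\<close>; the induction over the game tree passes
  through positions other than the initial one.\<close>

definition legal_from ::
    "(nat list \<Rightarrow> nat rel) \<Rightarrow> (nat rel \<Rightarrow> nat) \<Rightarrow> nat rel \<times> nat list \<Rightarrow> nat \<Rightarrow> bool" where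
  "legal_from A B p m \<longleftrightarrow> (\<forall>i<m. case (step A B ^^ i) p of (r, cols) \<Rightarrow>
     partial_order_on {..<Suc (length cols)} (A cols) \<and> Restr (A cols) {..<length cols} = r)"

text \<open>A play resumed at \<open>cols\<close> consults the strategy only on extensions of
  \<open>cols\<close>. Strategies for different answers of Bertha can therefore be glued without
  interfering.\<close>

lemma step_funpow_cong:
  assumes "\<And>ext. A (cols @ ext) = A' (cols @ ext)"
  shows "(step A B ^^ m) (r, cols) = (step A' B ^^ m) (r, cols)
    \<and> (\<exists>ext. snd ((step A B ^^ m) (r, cols)) = cols @ ext)"
proof (induction m)
  case (Suc m)
  then show ?case using assms by (auto simp: step_def)
qed simp

lemma legal_from_cong:
  assumes "\<And>ext. A (cols @ ext) = A' (cols @ ext)"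
  shows "legal_from A B (r, cols) m \<longleftrightarrow> legal_from A' B (r, cols) m"
proof -
  have "A (snd ((step A B ^^ i) (r, cols))) = A' (snd ((step A B ^^ i) (r, cols)))" for i
    using step_funpow_cong[of A cols A' i B r] assms by metis
  then show ?thesis
    using step_funpow_cong[of A cols A' _ B r, OF assms]
    by (simp add: legal_from_def case_prod_beta)
qed

text \<open>Induction over the game tree. \<open>A\<close> can be fixed before \<open>B\<close>
  because it sees Bertha's answers. The premise on \<open>cols\<close> says that the colours so far
  are those of \<open>B\<close> itself, which makes her next answer proper.\<close>

lemma force_strategy:
  assumes "force \<Phi> r cols"
  shows "\<exists>A. \<forall>B. online_algorithm B \<longrightarrow> cols = map (\<lambda>i. B (Restr r {..i})) [0..<length cols] \<longrightarrow>
    (\<exists>m. legal_from A B (r, cols) m \<and> case_prod \<Phi> ((step A B ^^ m) (r, cols)))"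
  using assms
proof (induction rule: force.induct)
  case (stop r cols)
  then show ?case by (auto simp: legal_from_def intro!: exI[of _ 0])
next
  case (move cols r' r)
  let ?P = "\<lambda>A c. \<forall>B. online_algorithm B \<longrightarrow>
    cols @ [c] = map (\<lambda>i. B (Restr r' {..i})) [0..<length (cols @ [c])] \<longrightarrow>
    (\<exists>m. legal_from A B (r', cols @ [c]) m \<and> case_prod \<Phi> ((step A B ^^ m) (r', cols @ [c])))"
  have "\<forall>c. \<exists>A. proper r' (cols @ [c]) \<longrightarrow> ?P A c"
    using move.IH by blast
  from choice[OF this] obtain A' where A': "\<forall>c. proper r' (cols @ [c]) \<longrightarrow> ?P (A' c) c" ..
  \<comment> \<open>The entry at index \<open>length cols\<close> is Bertha's answer to
    \<open>r'\<close>; it selects the strategy to continue with.\<close>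
  define A where "A l = (if l = cols then r' else A' (l ! length cols) l)" for l
  show ?case
  proof (intro exI[of _ A] allI impI)
    fix B assume B: "online_algorithm B"
      and cols: "cols = map (\<lambda>i. B (Restr r {..i})) [0..<length cols]"
    define n c where "n = length cols" and "c = B r'"
    have r'n: "Restr r' {..n} = r'"
      using move(1) by (auto simp: n_def partial_order_on_def preorder_on_def refl_on_def)
    have "Restr r' {..i} = Restr r {..i}" if "i < n" for i
      using that move(2) by (auto simp: n_def)
    then have "map (\<lambda>i. B (Restr r' {..i})) [0..<n] = map (\<lambda>i. B (Restr r {..i})) [0..<n]"
      by (intro map_cong) auto
    then have cols': "cols @ [c] = map (\<lambda>i. B (Restr r' {..i})) [0..<Suc n]"
      using cols r'n by (simp add: n_def c_def)
    have "proper r' (cols @ [c])"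
      unfolding proper_def
    proof (intro allI impI)
      fix i j assume ij: "i < length (cols @ [c])" "j < length (cols @ [c])"
        "(cols @ [c]) ! i = (cols @ [c]) ! j"
      have "{i. i < Suc n \<and> B (Restr r' {..i}) = (cols @ [c]) ! j} \<in> Chains r'"
        using B move(1) by (auto simp: online_algorithm_def n_def)
      moreover have "B (Restr r' {..l}) = (cols @ [c]) ! l" if "l < Suc n" for l
        unfolding cols' using that by (simp add: nth_append del: upt_Suc)
      then have "i \<in> {i. i < Suc n \<and> B (Restr r' {..i}) = (cols @ [c]) ! j}"
        "j \<in> {i. i < Suc n \<and> B (Restr r' {..i}) = (cols @ [c]) ! j}"
        using ij by (simp_all add: n_def)
      ultimately show "(i, j) \<in> r' \<or> (j, i) \<in> r'"
        unfolding Chains_def by blast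
    qed
    then have "?P (A' c) c"
      using A' by simp
    then obtain m where m: "legal_from (A' c) B (r', cols @ [c]) m"
        "case_prod \<Phi> ((step (A' c) B ^^ m) (r', cols @ [c]))"
      using B cols' by (auto simp: n_def)
    have ext: "A (cols @ [c] @ ext) = A' c (cols @ [c] @ ext)" for ext
      by (simp add: A_def)
    have st: "step A B (r, cols) = (r', cols @ [c])"
      by (simp add: step_def A_def c_def)
    have "legal_from A B (r, cols) (Suc m)"
      unfolding legal_from_def
    proof (intro allI impI)
      fix i assume "i < Suc m"
      then show "case (step A B ^^ i) (r, cols) of (r, cols) \<Rightarrow>
        partial_order_on {..<Suc (length cols)} (A cols) \<and> Restr (A cols) {..<length cols} = r"
      proof (cases i)
        case 0
        then show ?thesis using move(1,2) by (simp add: A_def)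
      next
        case (Suc j)
        have "legal_from A B (r', cols @ [c]) m"
          using m(1) legal_from_cong[of A "cols @ [c]" "A' c" B r' m] ext by simp
        then show ?thesis
          using Suc \<open>i < Suc m\<close> st unfolding legal_from_def
          by (simp add: funpow_Suc_right del: funpow.simps)
      qed
    qed
    moreover have "case_prod \<Phi> ((step A B ^^ Suc m) (r, cols))"
      using m(2) step_funpow_cong[of A "cols @ [c]" "A' c" m B r'] ext st
      by (simp add: funpow_Suc_right del: funpow.simps)
    ultimately show "\<exists>m. legal_from A B (r, cols) m \<and> case_prod \<Phi> ((step A B ^^ m) (r, cols))"
      by (intro exI[of _ "Suc m"] conjI)
  qed
qed

lemma length_colours_after [simp]: "length (colours_after A B n) = n"
  by (induction n) auto

lemma anna_forcesI:
  assumes "force (\<lambda>r cols. width {..<length cols} r \<le> w \<and> dimension {..<length cols} r \<le> d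
    \<and> k \<le> card (set cols)) {} []"
  shows "anna_forces w d k"
proof -
  have run: "(step A B ^^ m) ({}, []) = (poset_after A B m, colours_after A B m)" for A B m
    by (induction m) (auto simp: step_def)
  then have "legal_from A B ({}, []) m \<longleftrightarrow> legal_play A B m" for A B m
    by (simp add: legal_from_def legal_play_def)
  then show ?thesis
    using force_strategy[OF assms] by (auto simp: anna_forces_def run)
qed

section \<open>Posets given by two lists\<close>

primrec lrel :: "'a list \<Rightarrow> 'a rel" where
  "lrel [] = {}"
| "lrel (x # xs) = {x} \<times> set (x # xs) \<union> lrel xs"

lemma lrel_append: "lrel (xs @ ys) = lrel xs \<union> lrel ys \<union> set xs \<times> set ys"
  by (induction xs) auto

lemma lrel_subset: "lrel xs \<subseteq> set xs \<times> set xs"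
  by (induction xs) auto

lemma lrel_refl: "x \<in> set xs \<Longrightarrow> (x, x) \<in> lrel xs"
  by (induction xs) auto

lemma lrel_total: "x \<in> set xs \<Longrightarrow> y \<in> set xs \<Longrightarrow> (x, y) \<in> lrel xs \<or> (y, x) \<in> lrel xs"
  by (induction xs) auto

lemma lrel_antisym: "distinct xs \<Longrightarrow> (x, y) \<in> lrel xs \<Longrightarrow> (y, x) \<in> lrel xs \<Longrightarrow> x = y"
proof (induction xs)
  case (Cons a xs)
  then show ?case using lrel_subset[of xs] by auto
qed simp

lemma lrel_trans: "distinct xs \<Longrightarrow> (x, y) \<in> lrel xs \<Longrightarrow> (y, z) \<in> lrel xs \<Longrightarrow> (x, z) \<in> lrel xs"
proof (induction xs)
  case (Cons a xs)
  then show ?case using lrel_subset[of xs] by auto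
qed simp

lemma lrel_rev: "lrel (rev xs) = (lrel xs)\<inverse>"
  by (induction xs) (auto simp: lrel_append)

lemma lrel_linear: "distinct xs \<Longrightarrow> linear_order_on (set xs) (lrel xs)"
  unfolding linear_order_on_def partial_order_on_def preorder_on_def
  using lrel_subset[of xs] lrel_refl lrel_total[of _ xs]
  by (auto simp: refl_on_def total_on_def intro!: transI antisymI intro: lrel_trans lrel_antisym)

text \<open>Lists run from bottom to top. Presenting every poset as such an intersection keeps the
  dimension at most 2.\<close>

definition rel2 :: "'a list \<Rightarrow> 'a list \<Rightarrow> 'a rel" where
  "rel2 xs ys = lrel xs \<inter> lrel ys"

lemma rel2_partial_order:
  assumes "distinct xs" "distinct ys" "set ys = set xs"
  shows "partial_order_on (set xs) (rel2 xs ys)"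
proof -
  have "trans (lrel xs \<inter> lrel ys)" "antisym (lrel xs \<inter> lrel ys)"
    using lrel_linear[OF assms(1)] lrel_linear[OF assms(2)]
    by (auto simp: linear_order_on_def partial_order_on_def preorder_on_def antisym_def
        intro: trans_Int)
  moreover have "refl_on (set xs) (lrel xs \<inter> lrel ys)"
    using assms lrel_refl by (fastforce simp: refl_on_def)
  ultimately show ?thesis
    using lrel_subset[of xs]
    by (auto simp: rel2_def partial_order_on_def preorder_on_def)
qed

lemma rel2_swap: "rel2 ys xs = rel2 xs ys"
  by (auto simp: rel2_def)

lemma rel2_rev: "rel2 (rev xs) (rev ys) = (rel2 xs ys)\<inverse>"
  by (auto simp: rel2_def lrel_rev)

lemma dimension_rel2:
  assumes "distinct xs" "distinct ys" "set ys = set xs"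
  shows "dimension (set xs) (rel2 xs ys) \<le> 2"
proof -
  have "realizer (set xs) (rel2 xs ys) {lrel xs, lrel ys}"
    using lrel_linear[OF assms(1)] lrel_linear[OF assms(2)] assms
    by (auto simp: realizer_def rel2_def)
  then have "dimension (set xs) (rel2 xs ys) \<le> card {lrel xs, lrel ys}"
    unfolding dimension_def by (auto intro: Least_le)
  also have "\<dots> \<le> 2"
    by (simp add: card_insert_if)
  finally show ?thesis .
qed

text \<open>Upper bounds on the width stated without \<open>Max\<close>, so that antichains can be
  cut into pieces directly.\<close>

definition wd :: "'a list \<Rightarrow> 'a list \<Rightarrow> nat \<Rightarrow> bool" where
  "wd xs ys w \<longleftrightarrow> (\<forall>S\<subseteq>set xs. antichain (rel2 xs ys) S \<longrightarrow> card S \<le> w)"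

lemma width_le:
  assumes "wd xs ys w" shows "width (set xs) (rel2 xs ys) \<le> w"
proof -
  have "antichain (rel2 xs ys) {}"
    by (simp add: antichain_def)
  then have "{S. S \<subseteq> set xs \<and> antichain (rel2 xs ys) S} \<noteq> {}"
    by blast
  moreover have "finite {S. S \<subseteq> set xs \<and> antichain (rel2 xs ys) S}"
    by simp
  ultimately show ?thesis
    using assms unfolding width_def wd_def by (subst Max_le_iff) auto
qed

text \<open>The inserted block is a module: an outside point is below all of it if it comes before
  it in both lists, above all of it if it comes after it in both, and otherwise incomparable to all
  of it.\<close>

lemma rel2_insert:
  assumes "set xs = X" "set ys = X"
    and "X \<inter> set (as @ bs) = {}" "X \<inter> set (cs @ ds) = {}"
  shows "rel2 (as @ xs @ bs) (cs @ ys @ ds) = rel2 (as @ bs) (cs @ ds) \<union> rel2 xs ys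
    \<union> (set as \<inter> set cs) \<times> X \<union> X \<times> (set bs \<inter> set ds)"
proof -
  have out: "(p, q) \<notin> lrel zs" if "p \<notin> set zs \<or> q \<notin> set zs" for p q :: 'a and zs
    using that lrel_subset[of zs] by auto
  have "(p, q) \<in> rel2 (as @ xs @ bs) (cs @ ys @ ds) \<longleftrightarrow>
    (p, q) \<in> rel2 (as @ bs) (cs @ ds) \<union> rel2 xs ys \<union> (set as \<inter> set cs) \<times> X \<union>
      X \<times> (set bs \<inter> set ds)" for p q
  proof -
    have X: "p \<notin> set zs" if "p \<in> X" "zs \<in> {as, bs, cs, ds}" for p zs
      using that assms(3,4) by auto
    show ?thesis
    proof (cases "p \<in> X")
      case True
      then show ?thesis
        by (cases "q \<in> X") (simp_all add: rel2_def lrel_append assms(1,2) X out)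
    next
      case False
      then show ?thesis
        by (cases "q \<in> X") (simp_all add: rel2_def lrel_append assms(1,2) X out)
    qed
  qed
  then show ?thesis by auto
qed


lemma rel2_fill_mono: "rel2 (x1 @ x2) (y1 @ y2) \<subseteq> rel2 (x1 @ xs @ x2) (y1 @ ys @ y2)"
  by (auto simp: rel2_def lrel_append)

section \<open>Slots and re-embedding of their contents\<close>

definition valid :: "nat list \<Rightarrow> nat list \<Rightarrow> nat list \<Rightarrow> bool" where
  "valid xs ys cols \<longleftrightarrow> distinct xs \<and> distinct ys \<and> set xs = {..<length cols} \<and>
     set ys = {..<length cols} \<and> proper (rel2 xs ys) cols"

text \<open>A slot for new points is a position in each of the two lists, which \<open>as\<close>, \<open>bs\<close> and \<open>cs\<close>, \<open>ds\<close>
  are the parts before and after. The points introduced since \<open>cols\<close> are those of \<open>xs\<close> and \<open>ys\<close>.\<close>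

definition grown :: "nat list \<Rightarrow> nat list \<Rightarrow> nat list \<Rightarrow> nat list \<Rightarrow> nat list \<Rightarrow>
    nat rel \<Rightarrow> nat list \<Rightarrow> nat list \<Rightarrow> nat list \<Rightarrow> bool" where
  "grown as bs cs ds cols r' cols' xs ys \<longleftrightarrow>
     valid (as @ xs @ bs) (cs @ ys @ ds) cols' \<and> r' = rel2 (as @ xs @ bs) (cs @ ys @ ds) \<and>
     (\<exists>ext. cols' = cols @ ext) \<and> set ys = set xs \<and> set xs = {length cols..<length cols'}"

text \<open>Bertha sees only the intersection of the two orders, so Anna may change the lists behind
  it even after the answers.\<close>

definition same_poset :: "'a list \<Rightarrow> 'a list \<Rightarrow> 'a list \<Rightarrow> 'a list \<Rightarrow> bool" where
  "same_poset xs ys xs' ys' \<longleftrightarrow> rel2 xs' ys' = rel2 xs ys \<and> set xs' = set xs \<and>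
     set ys' = set xs \<and> set ys = set xs \<and> distinct xs' \<and> distinct ys'"

lemma grown_refl: "valid (as @ bs) (cs @ ds) cols \<Longrightarrow>
    grown as bs cs ds cols (rel2 (as @ bs) (cs @ ds)) cols [] []"
  by (simp add: grown_def)

text \<open>What is played in a slot inside the contents of another slot counts as contents of the
  outer one. This connects successive stages.\<close>

lemma grown_nested:
  assumes "grown as bs cs ds cols r cols1 (x1 @ x2) (y1 @ y2)"
    and "grown (as @ x1) (x2 @ bs) (cs @ y1) (y2 @ ds) cols1 r' cols2 xs ys"
  shows "grown as bs cs ds cols r' cols2 (x1 @ xs @ x2) (y1 @ ys @ y2)"
proof -
  have "length cols \<le> length cols1" "length cols1 \<le> length cols2"
    using assms by (auto simp: grown_def)
  then have "{length cols..<length cols2} = {length cols..<length cols1} \<union> {length cols1..<length cols2}"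
    by auto
  then show ?thesis
    using assms unfolding grown_def
    by (elim conjE exE, intro conjI) (simp_all, auto)
qed

lemma grown_valid:
  assumes "grown as bs cs ds cols r cols1 (x1 @ x2) (y1 @ y2)"
  shows "valid ((as @ x1) @ (x2 @ bs)) ((cs @ y1) @ (y2 @ ds)) cols1"
    and "r = rel2 ((as @ x1) @ (x2 @ bs)) ((cs @ y1) @ (y2 @ ds))"
  using assms by (auto simp: grown_def)

text \<open>By \<open>rel2_insert\<close>, a block enters the surrounding order only through its own
  poset and its point set.\<close>

lemma same_poset_fill:
  assumes "same_poset xs ys xs' ys'" "distinct (as @ xs @ bs)" "distinct (cs @ ys @ ds)"
    and "set (cs @ ys @ ds) = set (as @ xs @ bs)"
  shows "same_poset (as @ xs @ bs) (cs @ ys @ ds) (as @ xs' @ bs) (cs @ ys' @ ds)"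
proof -
  have "rel2 (as @ xs' @ bs) (cs @ ys' @ ds) = rel2 (as @ xs @ bs) (cs @ ys @ ds)"
    using assms
    by (subst (1 2) rel2_insert[where X = "set xs"]) (auto simp: same_poset_def)
  then show ?thesis
    using assms unfolding same_poset_def by auto
qed

lemma same_poset_swap:
  "distinct xs \<Longrightarrow> distinct ys \<Longrightarrow> set ys = set xs \<Longrightarrow> same_poset xs ys ys xs"
  by (auto simp: same_poset_def rel2_swap)

lemma same_poset_trans:
  "same_poset xs ys xs' ys' \<Longrightarrow> same_poset xs' ys' xs'' ys'' \<Longrightarrow> same_poset xs ys xs'' ys''"
  by (auto simp: same_poset_def)

lemma grown_same_poset:
  assumes "grown as bs cs ds cols r cols1 xs ys" "same_poset xs ys xs' ys'"
  shows "grown as bs cs ds cols r cols1 xs' ys'"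
proof -
  have "same_poset (as @ xs @ bs) (cs @ ys @ ds) (as @ xs' @ bs) (cs @ ys' @ ds)"
    using assms by (intro same_poset_fill) (auto simp: grown_def valid_def)
  then show ?thesis
    using assms unfolding grown_def valid_def same_poset_def by metis
qed

lemma grown_swap:
  assumes "grown as bs cs ds cols r cols1 xs ys"
  shows "grown as bs cs ds cols r cols1 ys xs"
  using assms by (rule grown_same_poset) (use assms in \<open>auto simp: grown_def valid_def intro: same_poset_swap\<close>)

lemma wd_same_poset: "same_poset xs ys xs' ys' \<Longrightarrow> wd xs' ys' w \<longleftrightarrow> wd xs ys w"
  by (simp add: wd_def same_poset_def)

lemma wd_swap: "set ys = set xs \<Longrightarrow> wd ys xs w \<longleftrightarrow> wd xs ys w"
  by (simp add: wd_def rel2_swap)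

text \<open>If an antichain meets the block, its other points lie on different sides of the block in
  the two lists, where at most \<open>u\<close> fit. If it misses the block, the first assumption
  bounds it.\<close>

lemma wd_fill:
  assumes "wd (x1 @ x2) (y1 @ y2) w" "wd xs ys v" "u + v \<le> w"
    and "\<And>S. S \<subseteq> (set x1 \<inter> set y2) \<union> (set x2 \<inter> set y1) \<Longrightarrow> antichain (rel2 (x1 @ x2) (y1 @ y2)) S \<Longrightarrow>
      card S \<le> u"
    and "set ys = set xs" "set (y1 @ y2) = set (x1 @ x2)" "set xs \<inter> set (x1 @ x2) = {}"
  shows "wd (x1 @ xs @ x2) (y1 @ ys @ y2) w"
  unfolding wd_def
proof (intro allI impI)
  let ?r = "rel2 (x1 @ xs @ x2) (y1 @ ys @ y2)"
  fix S assume S: "S \<subseteq> set (x1 @ xs @ x2)" "antichain ?r S"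
  have r: "?r = rel2 (x1 @ x2) (y1 @ y2) \<union> rel2 xs ys
      \<union> (set x1 \<inter> set y1) \<times> set xs \<union> set xs \<times> (set x2 \<inter> set y2)"
    by (rule rel2_insert) (use assms in auto)
  define S1 S2 where "S1 = S \<inter> set xs" and "S2 = S - set xs"
  have S1: "antichain (rel2 xs ys) S1" and S2: "antichain (rel2 (x1 @ x2) (y1 @ y2)) S2"
    using S(2) unfolding r antichain_def S1_def S2_def by blast+
  have sub: "S2 \<subseteq> set (x1 @ x2)"
    using S(1) by (auto simp: S2_def)
  have fin: "finite S"
    using S(1) finite_subset by blast
  have card: "card S = card S1 + card S2"
    using fin card_Un_disjoint[of S1 S2] by (auto simp: S1_def S2_def Int_Diff_Un)
  show "card S \<le> w"
  proof (cases "S1 = {}")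
    case True
    then show ?thesis
      using assms(1) S2 sub card by (simp add: wd_def)
  next
    case False
    then obtain a where a: "a \<in> S" "a \<in> set xs"
      by (auto simp: S1_def)
    have "b \<notin> set x1 \<inter> set y1 \<and> b \<notin> set x2 \<inter> set y2" if "b \<in> S2" for b
      using that a S(2) unfolding r antichain_def S2_def by blast
    then have "S2 \<subseteq> (set x1 \<inter> set y2) \<union> (set x2 \<inter> set y1)"
      using sub assms(6) by auto
    then have "card S2 \<le> u"
      using assms(4) S2 by blast
    moreover have "card S1 \<le> v"
      using assms(2) S1 by (simp add: wd_def S1_def)
    ultimately show ?thesis
      using card assms(3) by linarith
  qed
qed

definition chain_in :: "'a rel \<Rightarrow> 'a set \<Rightarrow> bool" where
  "chain_in r S \<longleftrightarrow> (\<forall>a\<in>S. \<forall>b\<in>S. (a, b) \<in> r \<or> (b, a) \<in> r)"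

lemma chain_in_mono: "chain_in r S \<Longrightarrow> r \<subseteq> r' \<Longrightarrow> chain_in r' S"
  by (auto simp: chain_in_def)

lemma chain_antichain_card:
  assumes "chain_in r C" "S \<subseteq> C" "antichain r S"
  shows "card S \<le> 1"
proof -
  have "a = b" if "a \<in> S" "b \<in> S" for a b
    using that assms unfolding chain_in_def antichain_def by blast
  then show ?thesis
    by (metis card.infinite card_le_Suc0_iff_eq One_nat_def zero_le)
qed

lemma wd_singleton: "wd [x] [x] (Suc 0)"
  unfolding wd_def using card_mono[of "{x}"] by fastforce

text \<open>One round of the game: the new point, named \<open>length cols\<close>, goes into the
  slot. As a one-point block it leaves the relations among the old points unchanged.\<close>

lemma grown_move:
  assumes g: "grown as bs cs ds cols0 r cols (x1 @ x2) (y1 @ y2)"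
    and next_state: "\<And>c r'. grown as bs cs ds cols0 r' (cols @ [c])
      (x1 @ [length cols] @ x2) (y1 @ [length cols] @ y2) \<Longrightarrow> force \<Phi> r' (cols @ [c])"
  shows "force \<Phi> r cols"
proof -
  let ?n = "length cols"
  let ?xs = "(as @ x1) @ [?n] @ (x2 @ bs)" and ?ys = "(cs @ y1) @ [?n] @ (y2 @ ds)"
  note v = grown_valid[OF g]
  have sets: "distinct ?xs" "distinct ?ys" "set ?xs = {..<Suc ?n}" "set ?ys = {..<Suc ?n}"
    using v(1) by (auto simp: valid_def lessThan_Suc)
  show ?thesis
  proof (rule force.move)
    show "partial_order_on {..<Suc ?n} (rel2 ?xs ?ys)"
      using rel2_partial_order[of ?xs ?ys] sets by simp
    have "rel2 ?xs ?ys = rel2 ((as @ x1) @ (x2 @ bs)) ((cs @ y1) @ (y2 @ ds)) \<union> rel2 [?n] [?n]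
      \<union> (set (as @ x1) \<inter> set (cs @ y1)) \<times> {?n} \<union> {?n} \<times> (set (x2 @ bs) \<inter> set (y2 @ ds))"
      by (rule rel2_insert) (use sets in auto)
    moreover have "rel2 ((as @ x1) @ (x2 @ bs)) ((cs @ y1) @ (y2 @ ds)) \<subseteq> {..<?n} \<times> {..<?n}"
      using v(1) lrel_subset[of "(as @ x1) @ (x2 @ bs)"] by (auto simp: valid_def rel2_def)
    ultimately show "Restr (rel2 ?xs ?ys) {..<?n} = r"
      using v(2) by (auto simp: rel2_def)
    fix c assume "proper (rel2 ?xs ?ys) (cols @ [c])"
    then show "force \<Phi> (rel2 ?xs ?ys) (cols @ [c])"
      using sets g by (intro next_state) (auto simp: grown_def valid_def)
  qed
qed

text \<open>Points of \<open>B\<close> lie on different sides of the block in the two lists, hence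
  are incomparable to it, and properness forbids a common colour.\<close>

lemma colours_disjoint:
  assumes "valid (p @ xs @ q) (s @ ys @ t) cols" "set ys = set xs"
    and "B \<subseteq> (set p \<inter> set t) \<union> (set q \<inter> set s)"
  shows "(!) cols ` set xs \<inter> (!) cols ` B = {}"
proof -
  have r: "rel2 (p @ xs @ q) (s @ ys @ t) = rel2 (p @ q) (s @ t) \<union> rel2 xs ys
      \<union> (set p \<inter> set s) \<times> set xs \<union> set xs \<times> (set q \<inter> set t)"
    by (rule rel2_insert) (use assms in \<open>auto simp: valid_def\<close>)
  have "cols ! a \<noteq> cols ! b" if ab: "a \<in> set xs" "b \<in> B" for a b
  proof
    assume "cols ! a = cols ! b"
    moreover have "a < length cols" "b < length cols"
      using ab assms by (auto simp: valid_def)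
    ultimately have "(a, b) \<in> rel2 (p @ xs @ q) (s @ ys @ t) \<or> (b, a) \<in> rel2 (p @ xs @ q) (s @ ys @ t)"
      using assms(1) unfolding valid_def proper_def by blast
    moreover have "b \<notin> set xs" "a \<notin> set (p @ q)"
      and "b \<notin> set p \<inter> set s" "b \<notin> set q \<inter> set t"
      using ab assms unfolding valid_def by auto
    moreover have "rel2 (p @ q) (s @ t) \<subseteq> set (p @ q) \<times> set (p @ q)"
      "rel2 xs ys \<subseteq> set xs \<times> set xs"
      using lrel_subset[of "p @ q"] lrel_subset[of xs] unfolding rel2_def by blast+
    ultimately show False
      unfolding r using ab by blast
  qed
  then show ?thesis by blast
qed

lemma image_nth_append: "X \<subseteq> {..<length cols} \<Longrightarrow> (!) (cols @ ext) ` X = (!) cols ` X"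
  by (rule image_cong) (auto simp: nth_append)

section \<open>Chains with many colours\<close>

text \<open>The next slot lies between \<open>D\<close> and \<open>T\<close> in the first list and after \<open>ys\<close> in the second, hence
  above \<open>D\<close> and incomparable to \<open>T\<close>.\<close>

definition chain_outcome :: "nat \<Rightarrow> nat list \<Rightarrow> nat list \<Rightarrow> nat list \<Rightarrow> nat list \<Rightarrow> nat list \<Rightarrow>
    nat rel \<Rightarrow> nat list \<Rightarrow> bool" where
  "chain_outcome k as bs cs ds cols r' cols' \<longleftrightarrow> (\<exists>D T ys.
     grown as bs cs ds cols r' cols' (D @ T) ys \<and> chain_in (rel2 (D @ T) ys) (set T) \<and>
     k \<le> card ((!) cols' ` set T) \<and> wd (D @ T) ys k)"

lemma chain_outcomeI:
  assumes "grown as bs cs ds cols r cols' (D @ T) ys" "chain_in (rel2 (D @ T) ys) (set T)"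
    "k \<le> card ((!) cols' ` set T)" "wd (D @ T) ys k"
  shows "chain_outcome k as bs cs ds cols r cols'"
  using assms unfolding chain_outcome_def by blast

lemma chain_in_top:
  assumes "chain_in (rel2 xs ys) C" "C \<subseteq> set xs" "set ys = set xs"
  shows "chain_in (rel2 (xs @ [v]) (ys @ [v])) (insert v C)"
  using assms by (auto simp: chain_in_def rel2_def lrel_append)

lemma wd_top:
  assumes "wd xs ys w" "w \<ge> 1" "v \<notin> set xs" "set ys = set xs"
  shows "wd (xs @ [v]) (ys @ [v]) w"
proof -
  have "wd (xs @ [v] @ []) (ys @ [v] @ []) w"
    using assms wd_singleton[of v] by (intro wd_fill[where u = 0 and v = 1]) auto
  then show ?thesis by simp
qed

text \<open>An antichain uses at most one point of a chain, so a chain left beside the slot costs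
  one unit of width.\<close>

lemma wd_fill_chain:
  assumes "wd (x1 @ x2) (y1 @ y2) (Suc v)" "wd xs ys v"
    and "chain_in (rel2 (x1 @ x2) (y1 @ y2)) ((set x1 \<inter> set y2) \<union> (set x2 \<inter> set y1))"
    and "set ys = set xs" "set (y1 @ y2) = set (x1 @ x2)" "set xs \<inter> set (x1 @ x2) = {}"
  shows "wd (x1 @ xs @ x2) (y1 @ ys @ y2) (Suc v)"
  by (rule wd_fill[where u = 1 and v = v])
    (use assms chain_antichain_card in \<open>simp_all, blast?\<close>)

text \<open>Next to \<open>T\<close>, Anna forces a chain \<open>T'\<close> with \<open>k\<close> colours not used on \<open>T\<close>, and then puts a point
  above everything. Its colour is new to \<open>T\<close> or to \<open>T'\<close>. In the first case \<open>T\<close> is prolonged and the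
  step repeated, \<open>i\<close> bounding the number of colours that \<open>T\<close> still lacks.\<close>

lemma force_chain_step:
  assumes F: "\<And>as bs cs ds cols. valid (as @ bs) (cs @ ds) cols \<Longrightarrow>
      force (chain_outcome k as bs cs ds cols) (rel2 (as @ bs) (cs @ ds)) cols"
    and "grown as bs cs ds cols0 r cols xs (D @ T)" "chain_in (rel2 xs (D @ T)) (set T)"
    and "wd xs (D @ T) (Suc k)" "Suc k \<le> i + card ((!) cols ` set T)"
  shows "force (chain_outcome (Suc k) as bs cs ds cols0) r cols"
  using assms(2-)
proof (induction i arbitrary: r cols xs D T)
  case 0
  \<comment> \<open>\<open>T\<close> now has \<open>Suc k\<close> colours. It ends the second list
    here but has to end the first one in \<open>chain_outcome\<close>, so the lists are
    exchanged.\<close>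
  have "grown as bs cs ds cols0 r cols (D @ T) xs"
    using 0 grown_swap by blast
  moreover have "wd (D @ T) xs (Suc k)"
    using 0 wd_swap[of "D @ T" xs] by (auto simp: grown_def)
  ultimately show ?case
    using 0 by (intro force.stop) (auto simp: chain_outcome_def rel2_swap[of xs])
next
  case (Suc i)
  note g = \<open>grown as bs cs ds cols0 r cols xs (D @ T)\<close>
  have g': "grown as bs cs ds cols0 r cols (xs @ []) (D @ T)"
    using g by simp
  show ?case
  proof (rule force_trans)
    show "force (chain_outcome k (as @ xs) ([] @ bs) (cs @ D) (T @ ds) cols) r cols"
      unfolding grown_valid(2)[OF g'] using F grown_valid(1)[OF g'] .
    fix r1 cols1 assume "chain_outcome k (as @ xs) ([] @ bs) (cs @ D) (T @ ds) cols r1 cols1"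
    then obtain D' T' ys' where
        g1: "grown (as @ xs) ([] @ bs) (cs @ D) (T @ ds) cols r1 cols1 (D' @ T') ys'"
      and T': "chain_in (rel2 (D' @ T') ys') (set T')" "k \<le> card ((!) cols1 ` set T')"
      and w': "wd (D' @ T') ys' k"
      unfolding chain_outcome_def by blast
    define v where "v = length cols1"
    \<comment> \<open>\<open>T'\<close> ends the first list and \<open>T\<close> still ends the
      second. Prolonged by a top point, \<open>T\<close> fits the induction hypothesis and
      \<open>T'\<close> fits \<open>chain_outcome\<close>.\<close>
    define X where "X = xs @ D' @ T'"
    define Y where "Y = D @ ys' @ T"
    have g2: "grown as bs cs ds cols0 r1 cols1 X Y"
      using grown_nested[OF g' g1] by (simp add: X_def Y_def)
    have sets: "set (D @ T) = set xs" "set ys' = set D' \<union> set T'"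
      "set (D' @ T') \<inter> set xs = {}" "set Y = set X" "set X \<subseteq> {..<v}" "set xs \<subseteq> {..<length cols}"
      and ext: "\<exists>ext. cols1 = cols @ ext"
      using g g1 g2 by (auto simp: grown_def v_def)
    have T: "chain_in (rel2 xs (D @ T)) (set T)"
      using Suc by simp
    have "wd (xs @ (D' @ T') @ []) (D @ ys' @ T) (Suc k)"
      using Suc.prems w' sets T
      by (intro wd_fill_chain) (auto simp: chain_in_def)
    then have wX: "wd X Y (Suc k)"
      by (simp add: X_def Y_def)
    have X0: "rel2 xs (D @ T) \<subseteq> rel2 X Y"
      using rel2_fill_mono[of xs "[]" D T "D' @ T'" ys'] by (simp add: X_def Y_def)
    have X1: "rel2 (D' @ T') ys' \<subseteq> rel2 X Y"
      by (auto simp: X_def Y_def rel2_def lrel_append)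
    have colT: "(!) cols1 ` set T = (!) cols ` set T"
      using ext sets image_nth_append by (metis (no_types, lifting) Un_upper2 set_append subset_trans)
    have disj: "(!) cols1 ` set (D' @ T') \<inter> (!) cols1 ` set T = {}"
      using g1 sets by (intro colours_disjoint[of "as @ xs" _ bs "cs @ D" ys' "T @ ds"])
        (auto simp: grown_def)
    show "force (chain_outcome (Suc k) as bs cs ds cols0) r1 cols1"
    proof (rule grown_move)
      show "grown as bs cs ds cols0 r1 cols1 (X @ []) (Y @ [])"
        using g2 by simp
      fix c r2 assume "grown as bs cs ds cols0 r2 (cols1 @ [c]) (X @ [length cols1] @ []) (Y @ [length cols1] @ [])"
      then have g3: "grown as bs cs ds cols0 r2 (cols1 @ [c]) (X @ [v]) (Y @ [v])"
        by (simp add: v_def)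
      have w3: "wd (X @ [v]) (Y @ [v]) (Suc k)"
        using wX sets by (intro wd_top) auto
      have c3: "(!) (cols1 @ [c]) ` set (Z @ [v]) = insert c ((!) cols1 ` set Z)"
        if "set Z \<subseteq> set X" for Z
        using that sets image_nth_append[of "set Z" cols1 "[c]"] by (auto simp: v_def)
      have ch3: "chain_in (rel2 (X @ [v]) (Y @ [v])) (set (Z @ [v]))"
        if "chain_in (rel2 X Y) (set Z)" "set Z \<subseteq> set X" for Z
        using chain_in_top[OF that sets(4)] by simp
      show "force (chain_outcome (Suc k) as bs cs ds cols0) r2 (cols1 @ [c])"
      proof (cases "c \<in> (!) cols1 ` set T")
        case False
        have TX: "set T \<subseteq> set X"
          using sets by (auto simp: X_def)
        show ?thesis
        proof (rule Suc.IH)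
          show "grown as bs cs ds cols0 r2 (cols1 @ [c]) (X @ [v]) ((D @ ys') @ T @ [v])"
            using g3 by (simp add: Y_def)
          show "wd (X @ [v]) ((D @ ys') @ T @ [v]) (Suc k)"
            using w3 by (simp add: Y_def)
          show "chain_in (rel2 (X @ [v]) ((D @ ys') @ T @ [v])) (set (T @ [v]))"
            using ch3[OF chain_in_mono[OF T X0] TX] by (simp add: Y_def)
          show "Suc k \<le> i + card ((!) (cols1 @ [c]) ` set (T @ [v]))"
            using Suc.prems(4) False colT c3[OF TX] by simp
        qed
      next
        case True
        have TX: "set T' \<subseteq> set X"
          by (auto simp: X_def)
        have "c \<notin> (!) cols1 ` set T'"
          using True disj by auto
        then have "Suc k \<le> card ((!) (cols1 @ [c]) ` set (T' @ [v]))"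
          using T' c3[OF TX] by simp
        then show ?thesis
          using g3 w3 ch3[OF chain_in_mono[OF T'(1) X1] TX]
          by (intro force.stop chain_outcomeI[where D = "xs @ D'" and T = "T' @ [v]"])
            (simp_all add: X_def)
      qed
    qed
  qed
qed

text \<open>Induction on \<open>k\<close>, over all slots at once because the hypothesis is used in
  a new slot each time. For \<open>Suc k\<close> the step starts with \<open>T\<close> empty,
  lacking all \<open>Suc k\<close> colours.\<close>

lemma force_chain:
  assumes "valid (as @ bs) (cs @ ds) cols"
  shows "force (chain_outcome k as bs cs ds cols) (rel2 (as @ bs) (cs @ ds)) cols"
  using assms
proof (induction k arbitrary: as bs cs ds cols)
  case 0
  have "grown as bs cs ds cols (rel2 (as @ bs) (cs @ ds)) cols ([] @ []) []"
    using grown_refl[OF 0] by simp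
  then show ?case
    by (intro force.stop chain_outcomeI[where D = "[]" and T = "[]" and ys = "[]"])
      (auto simp: chain_in_def wd_def)
next
  case (Suc k)
  show ?case
    using grown_refl[OF Suc.prems]
    by (intro force_chain_step[where xs = "[]" and D = "[]" and T = "[]" and i = "Suc k"] Suc.IH)
      (auto simp: chain_in_def wd_def)
qed


section \<open>The dual strategy and families of incomparable chains\<close>

lemma chain_in_converse [simp]: "chain_in (r\<inverse>) C \<longleftrightarrow> chain_in r C"
  by (auto simp: chain_in_def)

lemma antichain_converse [simp]: "antichain (r\<inverse>) S \<longleftrightarrow> antichain r S"
  unfolding antichain_def converse_iff by metis

lemma wd_rev: "set ys = set xs \<Longrightarrow> wd (rev ys) (rev xs) w \<longleftrightarrow> wd xs ys w"
  by (simp add: wd_def rel2_rev rel2_swap[of ys xs])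

lemma valid_rev: "valid (rev ys) (rev xs) cols \<longleftrightarrow> valid xs ys cols"
  unfolding valid_def rel2_rev rel2_swap[of ys xs] by auto

lemma grown_rev:
  assumes "grown (rev ds) (rev cs) (rev bs) (rev as) cols r cols' xs ys"
  shows "grown as bs cs ds cols (r\<inverse>) cols' (rev ys) (rev xs)"
proof -
  have "rev ds @ xs @ rev cs = rev (cs @ rev xs @ ds)" "rev bs @ ys @ rev as = rev (as @ rev ys @ bs)"
    by simp_all
  then show ?thesis
    using assms by (auto simp: grown_def valid_rev rel2_rev rel2_swap simp del: rev_append append_assoc)
qed

text \<open>The strategy of \<open>force_chain\<close> for the converse order. The lists are
  reversed and also exchanged, so that \<open>E\<close> starts the second list: a slot before
  \<open>xs\<close> in the first list and between \<open>E\<close> and \<open>U\<close> in the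
  second is incomparable to \<open>E\<close> and below \<open>U\<close>.\<close>

lemma force_chain_dual:
  assumes "valid (as @ bs) (cs @ ds) cols"
  shows "force (\<lambda>r' cols'. \<exists>E U xs. grown as bs cs ds cols r' cols' xs (E @ U) \<and>
      chain_in (rel2 xs (E @ U)) (set E) \<and> k \<le> card ((!) cols' ` set E) \<and> wd xs (E @ U) k)
    (rel2 (as @ bs) (cs @ ds)) cols"
proof -
  have "valid (rev ds @ rev cs) (rev bs @ rev as) cols"
    using assms valid_rev[of "cs @ ds" "as @ bs"] by simp
  from force_converse[OF force_chain[OF this, of k]]
  have "force (\<lambda>r' cols'. chain_outcome k (rev ds) (rev cs) (rev bs) (rev as) cols (r'\<inverse>) cols')
      (rel2 (as @ bs) (cs @ ds)) cols"
    using rel2_rev[of "cs @ ds" "as @ bs"] by (simp add: rel2_swap)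
  then show ?thesis
  proof (rule force_mono)
    fix r' cols'
    assume "chain_outcome k (rev ds) (rev cs) (rev bs) (rev as) cols (r'\<inverse>) cols'"
    then obtain D T ys where
        g: "grown (rev ds) (rev cs) (rev bs) (rev as) cols (r'\<inverse>) cols' (D @ T) ys"
      and c: "chain_in (rel2 (D @ T) ys) (set T)" "k \<le> card ((!) cols' ` set T)"
      and w: "wd (D @ T) ys k"
      unfolding chain_outcome_def by blast
    have s: "set ys = set (D @ T)"
      using g by (simp add: grown_def)
    have "rel2 (rev ys) (rev T @ rev D) = (rel2 (D @ T) ys)\<inverse>"
      using rel2_rev[of ys "D @ T"] by (simp add: rel2_swap)
    then show "\<exists>E U xs. grown as bs cs ds cols r' cols' xs (E @ U) \<and>
      chain_in (rel2 xs (E @ U)) (set E) \<and> k \<le> card ((!) cols' ` set E) \<and> wd xs (E @ U) k"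
      using grown_rev[OF g] c w wd_rev[OF s]
      by (intro exI[of _ "rev T"] exI[of _ "rev D"] exI[of _ "rev ys"]) simp
  qed
qed

text \<open>One poset with a separate embedding for each chain, always with \<open>T j\<close> at
  the end of the first list. This leaves open which chain the later play will keep beside its
  slot.\<close>

definition chains_outcome :: "nat \<Rightarrow> nat \<Rightarrow> nat list \<Rightarrow> nat list \<Rightarrow> nat list \<Rightarrow> nat list \<Rightarrow>
    nat list \<Rightarrow> nat rel \<Rightarrow> nat list \<Rightarrow> bool" where
  "chains_outcome m k as bs cs ds cols r' cols' \<longleftrightarrow> (\<exists>xs ys D T Y.
     grown as bs cs ds cols r' cols' xs ys \<and> wd xs ys (k + m) \<and>
     (\<forall>j\<le>m. same_poset xs ys (D j @ T j) (Y j) \<and>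
        chain_in (rel2 (D j @ T j) (Y j)) (set (T j)) \<and> k \<le> card ((!) cols' ` set (T j))) \<and>
     disjoint_family_on (\<lambda>j. (!) cols' ` set (T j)) {..m})"

text \<open>Induction on \<open>m\<close>: the chain \<open>T0\<close> is forced first, the others
  in the slot beside it. They share no colour with \<open>T0\<close>, which adds one to the
  width.\<close>

lemma force_chains:
  assumes "valid (as @ bs) (cs @ ds) cols"
  shows "force (chains_outcome m k as bs cs ds cols) (rel2 (as @ bs) (cs @ ds)) cols"
  using assms
proof (induction m arbitrary: as bs cs ds cols)
  case 0
  show ?case
  proof (rule force_mono[OF force_chain[OF 0, of k]])
    fix r' cols' assume "chain_outcome k as bs cs ds cols r' cols'"
    then obtain D T ys where *: "grown as bs cs ds cols r' cols' (D @ T) ys"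
        "chain_in (rel2 (D @ T) ys) (set T)" "k \<le> card ((!) cols' ` set T)" "wd (D @ T) ys k"
      unfolding chain_outcome_def by blast
    then have "same_poset (D @ T) ys (D @ T) ys"
      by (auto simp: same_poset_def grown_def valid_def)
    with * show "chains_outcome 0 k as bs cs ds cols r' cols'"
      unfolding chains_outcome_def
      by (intro exI[of _ "D @ T"] exI[of _ ys] exI[of _ "\<lambda>_. D"] exI[of _ "\<lambda>_. T"] exI[of _ "\<lambda>_. ys"])
        (simp add: disjoint_family_on_def)
  qed
next
  case (Suc m)
  show ?case
  proof (rule force_trans[OF force_chain[OF Suc.prems, of "k + Suc m"]])
    fix r1 cols1 assume "chain_outcome (k + Suc m) as bs cs ds cols r1 cols1"
    then obtain D0 T0 y0 where g: "grown as bs cs ds cols r1 cols1 (D0 @ T0) (y0 @ [])"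
      and c: "chain_in (rel2 (D0 @ T0) y0) (set T0)" "k + Suc m \<le> card ((!) cols1 ` set T0)"
      and w: "wd (D0 @ T0) y0 (k + Suc m)"
      unfolding chain_outcome_def by auto
    show "force (chains_outcome (Suc m) k as bs cs ds cols) r1 cols1"
      unfolding grown_valid(2)[OF g]
    proof (rule force_mono[OF Suc.IH[OF grown_valid(1)[OF g]]])
      fix r2 cols2
      assume "chains_outcome m k (as @ D0) (T0 @ bs) (cs @ y0) ([] @ ds) cols1 r2 cols2"
      then obtain xs ys D T Y where
          g1: "grown (as @ D0) (T0 @ bs) (cs @ y0) ([] @ ds) cols1 r2 cols2 xs ys"
        and w1: "wd xs ys (k + m)"
        and T: "\<And>j. j \<le> m \<Longrightarrow> same_poset xs ys (D j @ T j) (Y j)"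
          "\<And>j. j \<le> m \<Longrightarrow> chain_in (rel2 (D j @ T j) (Y j)) (set (T j))"
          "\<And>j. j \<le> m \<Longrightarrow> k \<le> card ((!) cols2 ` set (T j))"
        and disj: "disjoint_family_on (\<lambda>j. (!) cols2 ` set (T j)) {..m}"
        unfolding chains_outcome_def by blast
      note g2 = grown_nested[OF g g1]
      have d: "distinct (D0 @ xs @ T0)" "distinct (y0 @ ys)"
        and s: "set y0 = set (D0 @ T0)" "set ys = set xs" "set xs \<inter> set (D0 @ T0) = {}"
          "set T0 \<subseteq> {..<length cols1}" and ext: "\<exists>ext. cols2 = cols1 @ ext"
        using g g1 g2 by (auto simp: grown_def valid_def)
      \<comment> \<open>Index \<open>0\<close> is the new chain. The slot ends the second list, so
        for an inner chain the two lists are exchanged and the block is re-embedded with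
        \<open>T i\<close> last in what has become the first list.\<close>
      define D' where "D' = case_nat (D0 @ xs) (\<lambda>i. y0 @ D i)"
      define T' where "T' = case_nat T0 T"
      define Y' where "Y' = case_nat (y0 @ ys) (\<lambda>i. D0 @ Y i @ T0)"
      have col0: "(!) cols2 ` set T0 = (!) cols1 ` set T0"
        using ext s(4) image_nth_append by metis
      have T_sub: "set (T j) \<subseteq> set xs" if "j \<le> m" for j
        using T(1)[OF that] by (auto simp: same_poset_def)
      have disj0: "(!) cols2 ` set xs \<inter> (!) cols2 ` set T0 = {}"
        using g1 s by (intro colours_disjoint[of "as @ D0" _ "T0 @ bs" "cs @ y0" ys "ds"])
          (auto simp: grown_def)
      have "same_poset (D0 @ xs @ T0) (y0 @ ys) (D' j @ T' j) (Y' j) \<and>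
          chain_in (rel2 (D' j @ T' j) (Y' j)) (set (T' j)) \<and> k \<le> card ((!) cols2 ` set (T' j))"
        if "j \<le> Suc m" for j
      proof (cases j)
        case 0
        have "same_poset (D0 @ xs @ T0) (y0 @ ys) (D0 @ xs @ T0) (y0 @ ys)"
          using d s by (auto simp: same_poset_def)
        moreover have "chain_in (rel2 (D0 @ xs @ T0) (y0 @ ys)) (set T0)"
          using chain_in_mono[OF c(1)] rel2_fill_mono[of D0 T0 y0 "[]" xs ys] by simp
        ultimately show ?thesis
          using c(2) col0 by (simp add: 0 D'_def T'_def Y'_def)
      next
        case (Suc i)
        then have i: "i \<le> m" using that by simp
        have "same_poset ys xs (D i @ T i) (Y i)"
          by (rule same_poset_trans[OF same_poset_swap T(1)[OF i]]) (use d s in auto)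
        then have "same_poset (y0 @ ys @ []) (D0 @ xs @ T0) (y0 @ (D i @ T i) @ []) (D0 @ Y i @ T0)"
          using d s by (intro same_poset_fill) auto
        moreover have "same_poset (D0 @ xs @ T0) (y0 @ ys @ []) (y0 @ ys @ []) (D0 @ xs @ T0)"
          using d s by (intro same_poset_swap) auto
        ultimately have "same_poset (D0 @ xs @ T0) (y0 @ ys) (y0 @ D i @ T i) (D0 @ Y i @ T0)"
          using same_poset_trans[of "D0 @ xs @ T0" "y0 @ ys @ []"] by simp
        moreover have "rel2 (D i @ T i) (Y i) \<subseteq> rel2 (y0 @ D i @ T i) (D0 @ Y i @ T0)"
          by (auto simp: rel2_def lrel_append)
        ultimately show ?thesis
          using T(3)[OF i] chain_in_mono[OF T(2)[OF i]] by (simp add: Suc D'_def T'_def Y'_def)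
      qed
      moreover have "disjoint_family_on (\<lambda>j. (!) cols2 ` set (T' j)) {..Suc m}"
        unfolding disjoint_family_on_def
      proof (intro ballI impI)
        have *: "(!) cols2 ` set (T j) \<inter> (!) cols2 ` set T0 = {}" if "j \<le> m" for j
          using disj0 T_sub[OF that] by blast
        fix i j assume "i \<in> {..Suc m}" "j \<in> {..Suc m}" "i \<noteq> j"
        then show "(!) cols2 ` set (T' i) \<inter> (!) cols2 ` set (T' j) = {}"
          using * disj
          by (cases i; cases j) (auto simp: T'_def disjoint_family_on_def Int_commute)
      qed
      moreover have "wd (D0 @ xs @ T0) (y0 @ ys @ []) (Suc (k + m))"
        using w w1 c(1) s
        by (intro wd_fill_chain) (auto simp: chain_in_def)
      ultimately show "chains_outcome (Suc m) k as bs cs ds cols r2 cols2"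
        unfolding chains_outcome_def using g2
        by (intro exI[of _ "D0 @ xs @ T0"] exI[of _ "y0 @ ys"] exI[of _ D'] exI[of _ T'] exI[of _ Y'])
          simp
    qed
  qed
qed

section \<open>The lower bound\<close>

definition colours_outcome :: "nat \<Rightarrow> nat \<Rightarrow> nat list \<Rightarrow> nat list \<Rightarrow> nat list \<Rightarrow> nat list \<Rightarrow>
    nat list \<Rightarrow> nat rel \<Rightarrow> nat list \<Rightarrow> bool" where
  "colours_outcome w g as bs cs ds cols r' cols' \<longleftrightarrow> (\<exists>xs ys.
     grown as bs cs ds cols r' cols' xs ys \<and> wd xs ys w \<and> g \<le> card ((!) cols' ` set xs))"

text \<open>Averaging: the traces of the \<open>m + 1\<close> sets on \<open>E\<close> are disjoint,
  so the smallest has at most an equal share of \<open>E\<close>.\<close>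

lemma exists_small_intersection:
  assumes "disjoint_family_on A {..m}" "finite E"
  shows "\<exists>j\<le>m. Suc m * card (A j \<inter> E) \<le> card E"
proof (rule ccontr)
  assume "\<not> ?thesis"
  then have *: "card E < Suc m * card (A j \<inter> E)" if "j \<in> {..m}" for j
    using that by (metis atMost_iff not_le)
  have "Suc m * card E = (\<Sum>j\<le>m. card E)"
    by simp
  also have "\<dots> < (\<Sum>j\<le>m. Suc m * card (A j \<inter> E))"
    using * by (intro sum_strict_mono) auto
  also have "\<dots> = Suc m * (\<Sum>j\<le>m. card (A j \<inter> E))"
    by (simp only: sum_distrib_left)
  finally have "card E < (\<Sum>j\<le>m. card (A j \<inter> E))"
    by (simp only: mult_less_cancel1)
  also have "\<dots> = card (\<Union>j\<le>m. A j \<inter> E)"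
    using assms by (intro card_UN_disjoint[symmetric]) (auto simp: disjoint_family_on_def)
  also have "\<dots> \<le> card E"
    using assms(2) by (intro card_mono) auto
  finally show False by simp
qed

text \<open>Raising the argument by one raises the quotient by at most one. This handles an upper
  chain with more than \<open>w\<close> colours.\<close>

lemma minus_div_mono:
  fixes a b q :: nat
  assumes "a \<le> b"
  shows "a - a div Suc q \<le> b - b div Suc q"
proof -
  have "b div Suc q \<le> (a + (b - a) * Suc q) div Suc q"
    using assms by (intro div_le_mono) simp
  also have "\<dots> = a div Suc q + (b - a)"
    by (simp del: mult_Suc_right)
  finally show ?thesis
    using assms by linarith
qed

lemma card_Un_small_intersection:
  assumes "finite A" "finite E" "w \<le> card E" "k \<le> card A" "Suc m * card (A \<inter> E) \<le> card E"
  shows "w - w div Suc m + k \<le> card (A \<union> E)"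
proof -
  have "card (A \<inter> E) \<le> card E div Suc m"
    using assms(5) by (simp add: less_eq_div_iff_mult_less_eq mult.commute)
  moreover have "card E div Suc m \<le> card E"
    by simp
  moreover have "w - w div Suc m \<le> card E - card E div Suc m"
    using assms(3) by (rule minus_div_mono)
  moreover have "card A + card E = card (A \<union> E) + card (A \<inter> E)"
    using assms card_Un_Int by blast
  ultimately show ?thesis
    using assms(4) by linarith
qed

text \<open>Of the \<open>m + 1\<close> lower chains, only the one whose colours recur least in the upper chain \<open>E\<close> is
  kept outside the new slot; the other lower chains end up below it, the rest of the upper part
  above it.\<close>

lemma force_colours_step:
  assumes G: "\<And>as bs cs ds cols. valid (as @ bs) (cs @ ds) cols \<Longrightarrow>
      force (colours_outcome w g as bs cs ds cols) (rel2 (as @ bs) (cs @ ds)) cols"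
    and "m \<le> Suc w" and v: "valid (as @ bs) (cs @ ds) cols"
  shows "force (colours_outcome (Suc w) (g + (Suc w - Suc w div Suc m) + (Suc w - m)) as bs cs ds cols)
    (rel2 (as @ bs) (cs @ ds)) cols" (is "force ?\<Phi> _ _")
proof (rule force_trans[OF force_chains[OF v, of m "Suc w - m"]])
  fix r1 cols1 assume "chains_outcome m (Suc w - m) as bs cs ds cols r1 cols1"
  then obtain xs ys D T Y where g1: "grown as bs cs ds cols r1 cols1 (xs @ []) (ys @ [])"
    and w1: "wd xs ys (Suc w)"
    and T: "\<And>j. j \<le> m \<Longrightarrow> same_poset xs ys (D j @ T j) (Y j)"
      "\<And>j. j \<le> m \<Longrightarrow> chain_in (rel2 (D j @ T j) (Y j)) (set (T j))"
      "\<And>j. j \<le> m \<Longrightarrow> Suc w - m \<le> card ((!) cols1 ` set (T j))"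
    and disj: "disjoint_family_on (\<lambda>j. (!) cols1 ` set (T j)) {..m}"
    using \<open>m \<le> Suc w\<close> unfolding chains_outcome_def by fastforce
  show "force ?\<Phi> r1 cols1"
    unfolding grown_valid(2)[OF g1]
  proof (rule force_trans[OF force_chain_dual[OF grown_valid(1)[OF g1], of "Suc w"]])
    fix r2 cols2
    assume "\<exists>E U us. grown (as @ xs) ([] @ bs) (cs @ ys) ([] @ ds) cols1 r2 cols2 us (E @ U) \<and>
      chain_in (rel2 us (E @ U)) (set E) \<and> Suc w \<le> card ((!) cols2 ` set E) \<and> wd us (E @ U) (Suc w)"
    then obtain E U us where
        g2: "grown (as @ xs) ([] @ bs) (cs @ ys) ([] @ ds) cols1 r2 cols2 us (E @ U)"
      and E: "chain_in (rel2 us (E @ U)) (set E)" "Suc w \<le> card ((!) cols2 ` set E)"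
      and w2: "wd us (E @ U) (Suc w)"
      by blast
    obtain j where j: "j \<le> m"
        "Suc m * card ((!) cols1 ` set (T j) \<inter> (!) cols2 ` set E) \<le> card ((!) cols2 ` set E)"
      using exists_small_intersection[OF disj, of "(!) cols2 ` set E"] by auto
    have "grown as bs cs ds cols r2 cols2 (xs @ us @ []) (ys @ (E @ U) @ [])"
      using grown_nested[OF g1 g2] .
    moreover have s: "set ys = set xs" "set us = set E \<union> set U" "set xs \<inter> set us = {}"
      "set E \<inter> set U = {}" "distinct xs" "distinct ys" "distinct us" "distinct (E @ U)"
      "set xs \<subseteq> {..<length cols1}" and ext: "\<exists>ext. cols2 = cols1 @ ext"
      using g1 g2 by (auto simp: grown_def valid_def)
    \<comment> \<open>Only the lower part is re-embedded, so that \<open>T j\<close> ends its first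
      list.\<close>
    moreover have "same_poset ([] @ xs @ us) ([] @ ys @ (E @ U)) ([] @ (D j @ T j) @ us) ([] @ Y j @ (E @ U))"
      using s T(1)[OF j(1)] by (intro same_poset_fill) auto
    ultimately have g3: "grown as bs cs ds cols r2 cols2 (D j @ (T j @ us)) ((Y j @ E) @ U)"
      using grown_same_poset[of as bs cs ds cols r2 cols2 "xs @ us" "ys @ E @ U"] by simp
    have Dj: "set (Y j) = set xs" "set (D j) \<union> set (T j) = set xs" "set (D j) \<inter> set (T j) = {}"
      using T(1)[OF j(1)] by (auto simp: same_poset_def)
    let ?r = "rel2 (D j @ (T j @ us)) ((Y j @ E) @ U)"
    \<comment> \<open>The upper part lies above the whole lower part, so no antichain meets both and
      the widths do not add up.\<close>
    have "wd (xs @ us @ []) (ys @ (E @ U) @ []) (Suc w)"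
      using s w1 w2 by (intro wd_fill[where u = 0 and v = "Suc w"]) auto
    moreover have "same_poset (xs @ us) (ys @ E @ U) (D j @ (T j @ us)) ((Y j @ E) @ U)"
      using \<open>same_poset ([] @ xs @ us) _ _ _\<close> by simp
    ultimately have w3: "wd (D j @ (T j @ us)) ((Y j @ E) @ U) (Suc w)"
      using wd_same_poset by fastforce
    have chain: "chain_in ?r (set (T j) \<union> set E)"
    proof -
      have "chain_in ?r (set (T j))"
        by (rule chain_in_mono[OF T(2)[OF j(1)]]) (auto simp: rel2_def lrel_append)
      moreover have "chain_in ?r (set E)"
        by (rule chain_in_mono[OF E(1)]) (auto simp: rel2_def lrel_append)
      moreover have "set (T j) \<times> set E \<subseteq> ?r"
        using Dj s by (auto simp: rel2_def lrel_append)
      ultimately show ?thesis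
        unfolding chain_in_def by blast
    qed
    have "set (T j) \<subseteq> {..<length cols1}"
      using s Dj by blast
    then have "(!) cols2 ` set (T j) = (!) cols1 ` set (T j)"
      using ext image_nth_append by metis
    then have many: "Suc w - Suc w div Suc m + (Suc w - m) \<le> card ((!) cols2 ` (set (T j) \<union> set E))"
      using card_Un_small_intersection[OF _ _ E(2) T(3)[OF j(1)] j(2)] by (simp add: image_Un)
    show "force ?\<Phi> r2 cols2"
      unfolding grown_valid(2)[OF g3]
    proof (rule force_mono[OF G[OF grown_valid(1)[OF g3]]])
      fix r3 cols3
      assume "colours_outcome w g (as @ D j) ((T j @ us) @ bs) (cs @ Y j @ E) (U @ ds) cols2 r3 cols3"
      then obtain xs' ys' where
          g4: "grown (as @ D j) ((T j @ us) @ bs) (cs @ Y j @ E) (U @ ds) cols2 r3 cols3 xs' ys'"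
        and w4: "wd xs' ys' w" and c4: "g \<le> card ((!) cols3 ` set xs')"
        unfolding colours_outcome_def by blast
      have g5: "grown as bs cs ds cols r3 cols3 (D j @ xs' @ T j @ us) ((Y j @ E) @ ys' @ U)"
        using grown_nested[OF g3] g4 by simp
      have s': "set ys' = set xs'" "set xs' \<inter> set (D j @ T j @ us) = {}"
          "set (T j) \<union> set E \<subseteq> {..<length cols2}" and ext': "\<exists>ext. cols3 = cols2 @ ext"
        using g4 g3 s by (auto simp: grown_def valid_def)
      \<comment> \<open>The points incomparable to the new slot are exactly the kept chain. It adds
        one to the width \<open>w\<close> played there, and its colours cannot occur there.\<close>
      have "set (D j) \<inter> set U \<union> set (T j @ us) \<inter> set (Y j @ E) = set (T j) \<union> set E"
        using Dj s by auto
      then have w5: "wd (D j @ xs' @ T j @ us) ((Y j @ E) @ ys' @ U) (Suc w)"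
        using w3 w4 chain s' s Dj by (intro wd_fill_chain) auto
      have "(!) cols3 ` set xs' \<inter> (!) cols3 ` (set (T j) \<union> set E) = {}"
        using g4 s' Dj s
        by (intro colours_disjoint[of "as @ D j" _ "(T j @ us) @ bs" "cs @ Y j @ E" ys' "U @ ds"])
          (auto simp: grown_def)
      then have "card ((!) cols3 ` set xs') + card ((!) cols3 ` (set (T j) \<union> set E)) =
          card ((!) cols3 ` set xs' \<union> (!) cols3 ` (set (T j) \<union> set E))"
        by (simp add: card_Un_disjoint)
      moreover have "\<dots> \<le> card ((!) cols3 ` set (D j @ xs' @ T j @ us))"
        using s by (intro card_mono) auto
      moreover have "Suc w - Suc w div Suc m + (Suc w - m) \<le> card ((!) cols3 ` (set (T j) \<union> set E))"
        using many ext' image_nth_append[OF s'(3)] by metis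
      ultimately have "g + (Suc w - Suc w div Suc m) + (Suc w - m) \<le>
          card ((!) cols3 ` set (D j @ xs' @ T j @ us))"
        using c4 by linarith
      then show "?\<Phi> r3 cols3"
        unfolding colours_outcome_def using g5 w5 by blast
    qed
  qed
qed

text \<open>The choice \<open>m \<approx> sqrt w\<close> balances the two losses \<open>w div (m + 1)\<close> and \<open>m\<close>.\<close>

fun forced :: "nat \<Rightarrow> nat" where
  "forced 0 = 0"
| "forced (Suc w) = (let m = nat \<lfloor>sqrt (Suc w)\<rfloor> in
     forced w + (Suc w - Suc w div Suc m) + (Suc w - m))"

lemma floor_sqrt_le: "nat \<lfloor>sqrt (real w)\<rfloor> \<le> w"
proof -
  have "real w \<le> real (w\<^sup>2)"
    by (simp only: of_nat_le_iff) (simp add: power2_nat_le_imp_le power2_eq_square)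
  then have "sqrt (real w) \<le> real w"
    by (intro real_le_lsqrt) simp_all
  then show ?thesis
    by (simp add: nat_le_iff floor_le_iff)
qed

lemma force_colours:
  assumes "valid (as @ bs) (cs @ ds) cols"
  shows "force (colours_outcome w (forced w) as bs cs ds cols) (rel2 (as @ bs) (cs @ ds)) cols"
  using assms
proof (induction w arbitrary: as bs cs ds cols)
  case 0
  then show ?case
    using grown_refl by (intro force.stop) (force simp: colours_outcome_def wd_def)
next
  case (Suc w)
  then show ?case
    unfolding forced.simps Let_def
    by (intro force_colours_step floor_sqrt_le)
qed

lemma anna_forces_forced:
  assumes "2 \<le> d"
  shows "anna_forces w d (forced w)"
proof (rule anna_forcesI)
  have "valid ([] @ []) ([] @ []) []"
    by (simp add: valid_def proper_def)
  from force_colours[OF this, of w]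
  have "force (colours_outcome w (forced w) [] [] [] [] []) {} []"
    by (simp add: rel2_def)
  then show "force (\<lambda>r cols. width {..<length cols} r \<le> w \<and> dimension {..<length cols} r \<le> d
      \<and> forced w \<le> card (set cols)) {} []"
  proof (rule force_mono)
    fix r cols assume "colours_outcome w (forced w) [] [] [] [] [] r cols"
    then obtain xs ys where "wd xs ys w" "forced w \<le> card ((!) cols ` set xs)"
        "r = rel2 xs ys" "distinct xs" "distinct ys" "set ys = set xs" "set xs = {..<length cols}"
      by (auto simp: colours_outcome_def grown_def valid_def)
    moreover have "(!) cols ` {..<length cols} = set cols"
      by (auto simp: in_set_conv_nth)
    ultimately show "width {..<length cols} r \<le> w \<and> dimension {..<length cols} r \<le> d
        \<and> forced w \<le> card (set cols)"
      using width_le[of xs ys w] dimension_rel2[of xs ys] assms by simp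
  qed
qed

text \<open>With \<open>W = w + 1\<close>, the choice of \<open>m\<close> makes both losses at most
  \<open>sqrt W\<close>, so a step gains at least \<open>2 * W - 2 * sqrt W\<close>. The main terms
  sum to \<open>w * (w + 1)\<close>; bounding each earlier root by the last one gives
  \<open>2 * w * sqrt w\<close> for the losses.\<close>

lemma forced_ge: "real w * (real w + 1) - 2 * real w * sqrt w \<le> real (forced w)"
proof (induction w)
  case (Suc w)
  let ?W = "real (Suc w)"
  define m where "m = nat \<lfloor>sqrt ?W\<rfloor>"
  have m: "real m \<le> sqrt ?W" "sqrt ?W \<le> real (Suc m)"
    unfolding m_def by (simp_all add: of_nat_nat floor_le_iff) linarith
  have "real (Suc w div Suc m) \<le> ?W / real (Suc m)"
    by (rule of_nat_div_le_of_nat)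
  also have "\<dots> \<le> ?W / sqrt ?W"
    using m(2) by (intro divide_left_mono) auto
  also have "\<dots> = sqrt ?W"
    by (simp add: real_div_sqrt)
  finally have d: "real (Suc w div Suc m) \<le> sqrt ?W" .
  have "real w * sqrt w \<le> real w * sqrt ?W"
    by (intro mult_left_mono) auto
  moreover have "real (forced (Suc w)) = real (forced w) + (?W - real (Suc w div Suc m)) + (?W - real m)"
  proof -
    have "m \<le> Suc w" "Suc w div Suc m \<le> Suc w"
      using floor_sqrt_le[of "Suc w"] by (simp_all add: m_def del: of_nat_Suc)
    then show ?thesis
      unfolding forced.simps Let_def m_def[symmetric] by (simp only: of_nat_add of_nat_diff)
  qed
  ultimately show ?case
    using Suc d m(1) by (simp add: algebra_simps)
qed simp

theorem theorem1p1:
  shows "\<exists>f :: nat \<Rightarrow> real. f \<longlonglongrightarrow> 0 \<and>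
    (\<forall>w d :: nat. 1 \<le> w \<longrightarrow> 2 \<le> d \<longrightarrow>
       ereal_of_enat (olw w d) \<ge> ereal ((2 - f w) * real ((w + 1) choose 2)))"
proof (intro exI[of _ "\<lambda>w. 4 * sqrt (real w) / (real w + 1)"] conjI allI impI)
  \<comment> \<open>This \<open>f\<close> is the loss \<open>2 * w * sqrt w\<close> from
    \<open>forced_ge\<close> divided by the binomial coefficient
    \<open>w * (w + 1) / 2\<close>.\<close>
  show "(\<lambda>w. 4 * sqrt (real w) / (real w + 1)) \<longlonglongrightarrow> 0"
  proof (rule tendsto_sandwich[of "\<lambda>_. 0"])
    show "(\<lambda>w. 4 / sqrt (real w)) \<longlonglongrightarrow> 0"
      by (intro tendsto_divide_0[OF tendsto_const] filterlim_at_top_imp_at_infinity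
          filterlim_compose[OF sqrt_at_top filterlim_real_sequentially])
    have "4 * sqrt (real w) / (real w + 1) \<le> 4 / sqrt (real w)" if "w \<ge> 1" for w
      using that by (simp add: divide_simps mult.assoc)
    then show "\<forall>\<^sub>F w in sequentially. 4 * sqrt (real w) / (real w + 1) \<le> 4 / sqrt (real w)"
      using eventually_ge_at_top[of 1] by (rule eventually_mono[rotated])
  qed (auto intro: always_eventually)
  fix w d :: nat
  assume "1 \<le> w" "2 \<le> d"
  have "2 * ((w + 1) choose 2) = w * (w + 1)"
    by (simp add: choose_two)
  then have "2 * real ((w + 1) choose 2) = real w * (real w + 1)"
    by (metis of_nat_1 of_nat_add of_nat_mult of_nat_numeral)
  then have "real ((w + 1) choose 2) = real w * (real w + 1) / 2"
    by linarith
  then have "(2 - 4 * sqrt w / (real w + 1)) * real ((w + 1) choose 2) =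
      real w * (real w + 1) - 2 * real w * sqrt w"
    by (simp only:) (simp add: field_simps)
  also have "\<dots> \<le> real (forced w)"
    by (rule forced_ge)
  finally have "ereal ((2 - 4 * sqrt w / (real w + 1)) * real ((w + 1) choose 2)) \<le>
      ereal_of_enat (enat (forced w))"
    by simp
  also have "\<dots> \<le> ereal_of_enat (olw w d)"
    using anna_forces_forced[OF \<open>2 \<le> d\<close>, of w]
    by (simp only: ereal_of_enat_le_iff olw_def) (simp add: SUP_upper)
  finally show "ereal ((2 - 4 * sqrt w / (real w + 1)) * real ((w + 1) choose 2)) \<le>
    ereal_of_enat (olw w d)" .
qed

end
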